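(* Let $G$ be a topological group, let $(X,d)$ be a metrizable (compact) RN $G$-system, and let $M$ be its mincenter. Then $Eq(M)$ is a disjoint union of minimal equicontinuous systems, each a capturing subset of $M$.
   Context: A compact metrizable $G$-system is a compact metric space $(X,d)$ with a (jointly) continuous left action of the topological group $G$. A nonempty closed invariant subset is minimal if each of its points has dense orbit in it. The mincenter of $X$ is the closure of the union of all minimal subsets of $X$; it is a closed invariant subset. For a closed invariant subset $M$, $Eq(M)$ is the set of points $x_0\in M$ such that for every $\varepsilon>0$ there is a neighborhood $U$ of $x_0$ in $M$ with $d(gx_0,gx)<\varepsilon$ for all $x\in U$, $g\in G$. A system $Y$ is equicontinuous if $Eq(Y)=Y$. For closed invariant sets $A\subset B\subset X$, $A$ is capturing in $B$ if $x\in B$ and $\overline{Gx}\cap A\ne\emptyset$ imply $x\in A$. RN: a Banach space $V$ is Asplund if every separable Banach subspace has separable dual. $\mathrm{Iso}(V)$ is the group of linear isometries of $V$ onto itself. $X$ is Radon-Nikodým (RN) if there exist an Asplund space $V$, a strongly continuous co-homomorphism $h:G\to\mathrm{Iso}(V)$ (i.e. $h(gg')=h(g')h(g)$, and $g\mapsto h(g)v$ is norm continuous for each $v$), and a bounded topological embedding $\alpha:X\to(V^*,\text{weak}^* )$ with $\alpha(gx)=g\alpha(x)$, where $(g\varphi)(v)=\varphi(h(g)(v))$. *)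

theory Defs
  imports "HOL-Analysis.Analysis"
begin

text \<open>The acting group is a type of class \<open>topological_group_add\<close>. This class is not commutative
  (it extends \<open>group_add\<close>); its group law is merely written additively, so \<open>0\<close> is the
  neutral element and \<open>g + h\<close> is the product \<open>gh\<close>. Systems live on compact subsets of a
  type of class \<open>metric_space\<close>, so that subsystems are systems with the same action.\<close>

section \<open>Compact metric systems\<close>

definition G_system :: "('g::topological_group_add \<Rightarrow> 'x::metric_space \<Rightarrow> 'x) \<Rightarrow> 'x set \<Rightarrow> bool" where
  "G_system act X \<longleftrightarrow>
     compact X \<and>
     (\<forall>g. \<forall>x\<in>X. act g x \<in> X) \<and>
     (\<forall>x\<in>X. act 0 x = x) \<and>
     (\<forall>g h. \<forall>x\<in>X. act (g + h) x = act g (act h x)) \<and>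
     continuous_on (UNIV \<times> X) (\<lambda>(g, x). act g x)"

definition orbit :: "('g \<Rightarrow> 'x \<Rightarrow> 'x) \<Rightarrow> 'x \<Rightarrow> 'x set" where
  "orbit act x = range (\<lambda>g. act g x)"

definition closed_invariant ::
    "('g \<Rightarrow> 'x::metric_space \<Rightarrow> 'x) \<Rightarrow> 'x set \<Rightarrow> 'x set \<Rightarrow> bool" where
  "closed_invariant act X A \<longleftrightarrow>
     A \<subseteq> X \<and> closedin (top_of_set X) A \<and> (\<forall>g. \<forall>x\<in>A. act g x \<in> A)"

definition minimal_subset ::
    "('g \<Rightarrow> 'x::metric_space \<Rightarrow> 'x) \<Rightarrow> 'x set \<Rightarrow> 'x set \<Rightarrow> bool" where
  "minimal_subset act X Y \<longleftrightarrow>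
     closed_invariant act X Y \<and> Y \<noteq> {} \<and> (\<forall>y\<in>Y. Y \<subseteq> closure (orbit act y))"

text \<open>For compact \<open>X\<close>, closures of subsets of \<open>X\<close> in the ambient type and in \<open>X\<close> agree.\<close>

definition mincenter :: "('g \<Rightarrow> 'x::metric_space \<Rightarrow> 'x) \<Rightarrow> 'x set \<Rightarrow> 'x set" where
  "mincenter act X = closure (\<Union>{Y. minimal_subset act X Y})"

definition Eq_points :: "('g \<Rightarrow> 'x::metric_space \<Rightarrow> 'x) \<Rightarrow> 'x set \<Rightarrow> 'x set" where
  "Eq_points act M =
     {x0 \<in> M. \<forall>\<epsilon>>0. \<exists>U. openin (top_of_set M) U \<and> x0 \<in> U \<and>
        (\<forall>x\<in>U. \<forall>g. dist (act g x0) (act g x) < \<epsilon>)}"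

definition equicontinuous_system :: "('g \<Rightarrow> 'x::metric_space \<Rightarrow> 'x) \<Rightarrow> 'x set \<Rightarrow> bool" where
  "equicontinuous_system act Y \<longleftrightarrow> Eq_points act Y = Y"

definition capturing ::
    "('g \<Rightarrow> 'x::metric_space \<Rightarrow> 'x) \<Rightarrow> 'x set \<Rightarrow> 'x set \<Rightarrow> 'x set \<Rightarrow> bool" where
  "capturing act X A B \<longleftrightarrow>
     closed_invariant act X A \<and> closed_invariant act X B \<and> A \<subseteq> B \<and>
     (\<forall>x\<in>B. closure (orbit act x) \<inter> A \<noteq> {} \<longrightarrow> x \<in> A)"

section \<open>Asplund spaces\<close>

text \<open>The dual of a subspace \<open>W\<close>: since \<open>W\<close> is not a type, its functionals are represented by total
  functions of which only the values on \<open>W\<close> matter. Two representatives of the same functional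
  are at distance 0 for the operator norm on \<open>W\<close>, so separability is unaffected.\<close>

definition dual_on :: "'v::real_normed_vector set \<Rightarrow> ('v \<Rightarrow> real) set" where
  "dual_on W =
     {f. (\<forall>x\<in>W. \<forall>y\<in>W. f (x + y) = f x + f y) \<and>
         (\<forall>c. \<forall>x\<in>W. f (c *\<^sub>R x) = c * f x) \<and>
         (\<exists>K. \<forall>x\<in>W. \<bar>f x\<bar> \<le> K * norm x)}"

definition dual_norm_on :: "'v::real_normed_vector set \<Rightarrow> ('v \<Rightarrow> real) \<Rightarrow> real" where
  "dual_norm_on W f = (SUP x\<in>{x\<in>W. norm x \<le> 1}. \<bar>f x\<bar>)"

definition separable_dual_on :: "'v::real_normed_vector set \<Rightarrow> bool" where
  "separable_dual_on W \<longleftrightarrow>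
     (\<exists>D. countable D \<and> D \<subseteq> dual_on W \<and>
        (\<forall>f\<in>dual_on W. \<forall>\<epsilon>>0. \<exists>d\<in>D. dual_norm_on W (\<lambda>x. f x - d x) < \<epsilon>))"

definition Asplund :: "'v::banach itself \<Rightarrow> bool" where
  "Asplund TYPE('v) \<longleftrightarrow>
     (\<forall>W::'v set. subspace W \<and> closed W \<and> separable_space (top_of_set W) \<longrightarrow> separable_dual_on W)"

section \<open>Radon-Nikodym systems\<close>

definition Iso :: "('v::real_normed_vector \<Rightarrow> 'v) set" where
  "Iso = {T. linear T \<and> (\<forall>v. norm (T v) = norm v) \<and> surj T}"

text \<open>On functionals, the topology of pointwise convergence is the weak-star topology.\<close>

abbreviation weak_star_topology :: "('v::real_normed_vector \<Rightarrow>\<^sub>L real) topology" where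
  "weak_star_topology \<equiv> strong_operator_topology"

text \<open>\<open>RN_system TYPE('v) act X\<close>: the system is Radon-Nikodym, witnessed by a representation on the
  Asplund space \<open>'v\<close>. One cannot quantify existentially over \<open>'v\<close> inside a formula; as a
  hypothesis with \<open>'v\<close> a type variable not occurring in the conclusion, this says that some
  such space exists.\<close>

definition RN_system ::
    "'v::banach itself \<Rightarrow> ('g::topological_group_add \<Rightarrow> 'x::metric_space \<Rightarrow> 'x) \<Rightarrow> 'x set \<Rightarrow> bool" where
  "RN_system TYPE('v) act X \<longleftrightarrow>
     Asplund TYPE('v) \<and>
     (\<exists>(h :: 'g \<Rightarrow> 'v \<Rightarrow> 'v) (\<alpha> :: 'x \<Rightarrow> 'v \<Rightarrow>\<^sub>L real).
        range h \<subseteq> Iso \<and>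
        (\<forall>g g'. h (g + g') = h g' \<circ> h g) \<and>
        (\<forall>v. continuous_on UNIV (\<lambda>g. h g v)) \<and>
        bounded (\<alpha> ` X) \<and>
        embedding_map (top_of_set X) weak_star_topology \<alpha> \<and>
        (\<forall>g. \<forall>x\<in>X. \<forall>v. blinfun_apply (\<alpha> (act g x)) v = blinfun_apply (\<alpha> x) (h g v)))"

end

theory Submission
  imports Defs
begin

text \<open>An equicontinuity point \<open>x\<close> of the mincenter \<open>M\<close> is a limit of points of minimal sets, and
  near \<open>x\<close> whole orbits stay uniformly close. So the orbit of \<open>x\<close> is shadowed, up to any
  \<open>\<epsilon>\<close>, by the orbit of a point \<open>y\<close> of a minimal set. The latter returns near \<open>y\<close> from
  everywhere in its closure, hence the former returns near \<open>x\<close> from everywhere in its closure,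
  and the orbit closure of \<open>x\<close> is minimal (\<open>minimal_orbit_closure_of_Eq_point\<close>).

  On the other hand, equicontinuity can be pulled back along orbits: a point whose orbit
  accumulates at an equicontinuity point is itself one, because the elements \<open>g + k\<close> with \<open>k\<close>
  fixed exhaust the group (\<open>Eq_points_pullback\<close>). For points of a minimal orbit closure this shows
  that it consists of equicontinuity points. For an arbitrary point \<open>x\<close> of \<open>M\<close> whose orbit
  accumulates at such a minimal set \<open>Y\<close> it shows that \<open>x\<close> is an equicontinuity point, so that
  the orbit closure of \<open>x\<close> is minimal too; meeting \<open>Y\<close>, it equals \<open>Y\<close>, and \<open>Y\<close> is
  capturing. The required family consists of the orbit closures of the equicontinuity points.\<close>

section \<open>Subsystems, orbit closures and minimal sets\<close>

lemma G_systemD: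
  assumes "G_system act X"
  shows "compact X"
    and "x \<in> X \<Longrightarrow> act g x \<in> X"
    and "x \<in> X \<Longrightarrow> act 0 x = x"
    and "x \<in> X \<Longrightarrow> act (g + h) x = act g (act h x)"
  using assms unfolding G_system_def by auto

lemma continuous_on_act:
  assumes "G_system act X"
  shows "continuous_on X (act g)"
proof -
  have "continuous_on (UNIV \<times> X) (\<lambda>(g, x). act g x)"
    using assms unfolding G_system_def by auto
  moreover have "continuous_on X (\<lambda>x. (g, x))"
    by (intro continuous_intros)
  ultimately have "continuous_on X ((\<lambda>(g, x). act g x) \<circ> (\<lambda>x. (g, x)))"
    by (intro continuous_on_compose) (auto intro: continuous_on_subset)
  then show ?thesis
    by (simp add: o_def)
qed

lemma G_system_closed_invariant:
  assumes "G_system act X" and "closed_invariant act X A"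
  shows "G_system act A"
proof -
  have "compact A"
    using assms closedin_compact unfolding G_system_def closed_invariant_def by blast
  moreover have "continuous_on (UNIV \<times> A) (\<lambda>(g, x). act g x)"
    using assms unfolding G_system_def closed_invariant_def
    by (auto elim!: continuous_on_subset)
  ultimately show ?thesis
    using assms unfolding G_system_def closed_invariant_def by blast
qed

lemma closed_invariant_iff_closed:
  assumes "G_system act X"
  shows "closed_invariant act X A \<longleftrightarrow> A \<subseteq> X \<and> closed A \<and> (\<forall>g. \<forall>x\<in>A. act g x \<in> A)"
  using compact_imp_closed[OF G_systemD(1)[OF assms]] closedin_closed_eq
  unfolding closed_invariant_def by auto

lemma minimal_subset_subsystem:
  assumes "G_system act X" and "closed_invariant act X A"
  shows "minimal_subset act A Y \<longleftrightarrow> minimal_subset act X Y \<and> Y \<subseteq> A"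
  using assms closed_invariant_iff_closed[OF assms(1)]
    closed_invariant_iff_closed[OF G_system_closed_invariant[OF assms]]
  unfolding minimal_subset_def by auto

lemma closed_invariant_closure:
  assumes X: "G_system act X" and S: "S \<subseteq> X" and inv: "\<And>g x. x \<in> S \<Longrightarrow> act g x \<in> S"
  shows "closed_invariant act X (closure S)"
proof -
  have sub: "closure S \<subseteq> X"
    using S compact_imp_closed[OF G_systemD(1)[OF X]] by (simp add: closure_minimal)
  have "act g ` closure S \<subseteq> closure S" for g
  proof (rule image_closure_subset)
    show "continuous_on (closure S) (act g)"
      using continuous_on_act[OF X] sub by (rule continuous_on_subset)
    show "act g ` S \<subseteq> closure S"
      using inv closure_subset by fastforce
  qed simp
  then show ?thesis
    using sub unfolding closed_invariant_iff_closed[OF X] by auto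
qed

lemma closed_invariant_orbit_closure:
  assumes "G_system act X" and "x \<in> X"
  shows "closed_invariant act X (closure (orbit act x))"
proof (rule closed_invariant_closure[OF assms(1)])
  show "orbit act x \<subseteq> X"
    using G_systemD(2)[OF assms(1)] assms(2) by (auto simp: orbit_def)
  show "act g y \<in> orbit act x" if "y \<in> orbit act x" for g y
    using that G_systemD(4)[OF assms, symmetric] by (auto simp: orbit_def)
qed

lemma orbit_closure_subset:
  assumes "G_system act X" and "closed_invariant act X A" and "x \<in> A"
  shows "closure (orbit act x) \<subseteq> A"
  using assms closed_invariant_iff_closed[OF assms(1)]
  by (intro closure_minimal) (auto simp: orbit_def)

lemma in_orbit_closure:
  assumes "G_system act X" and "x \<in> X"
  shows "x \<in> closure (orbit act x)"
  using G_systemD(3)[OF assms] closure_subset[of "orbit act x"]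
  unfolding orbit_def by (metis rangeI subsetD)

lemma minimal_subset_eq_orbit_closure:
  assumes "G_system act X" and "minimal_subset act X Y" and "y \<in> Y"
  shows "Y = closure (orbit act y)"
  using assms orbit_closure_subset[OF assms(1)] unfolding minimal_subset_def by blast

lemma closed_invariant_mincenter:
  assumes "G_system act X"
  shows "closed_invariant act X (mincenter act X)"
  unfolding mincenter_def
proof (rule closed_invariant_closure[OF assms])
  show "\<Union>{Y. minimal_subset act X Y} \<subseteq> X"
    unfolding minimal_subset_def closed_invariant_def by blast
  show "act g x \<in> \<Union>{Y. minimal_subset act X Y}" if x: "x \<in> \<Union>{Y. minimal_subset act X Y}" for g x
  proof -
    obtain Y where "minimal_subset act X Y" "x \<in> Y"
      using x by blast
    moreover from this have "act g x \<in> Y"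
      by (simp add: minimal_subset_def closed_invariant_def)
    ultimately show ?thesis
      by blast
  qed
qed

section \<open>Equicontinuity points\<close>

lemma Eq_pointsE:
  assumes "x \<in> Eq_points act X" and "\<epsilon> > 0"
  obtains T where "open T" and "x \<in> T"
    and "\<And>u g. u \<in> X \<inter> T \<Longrightarrow> dist (act g x) (act g u) < \<epsilon>"
proof -
  have "\<exists>U. openin (top_of_set X) U \<and> x \<in> U \<and>
      (\<forall>u\<in>U. \<forall>g. dist (act g x) (act g u) < \<epsilon>)"
    using assms by (simp add: Eq_points_def)
  then show thesis
    using that unfolding openin_open by auto
qed

text \<open>The orbit of \<open>x\<close> enters every neighborhood of \<open>y\<close>. If \<open>act k x\<close> lies in a neighborhood
  witnessing equicontinuity at \<open>y\<close>, the preimage of that neighborhood under \<open>act k\<close> is a witness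
  for \<open>x\<close>, at the cost of one use of the triangle inequality.\<close>

lemma Eq_points_pullback:
  assumes X: "G_system act X" and x: "x \<in> X"
    and y: "y \<in> Eq_points act X" "y \<in> closure (orbit act x)"
  shows "x \<in> Eq_points act X"
  unfolding Eq_points_def
proof (intro CollectI conjI allI impI x)
  fix \<epsilon> :: real
  assume "\<epsilon> > 0"
  then have "\<epsilon>/2 > 0"
    by simp
  then obtain T where T: "open T" "y \<in> T"
      and close: "\<And>u g. u \<in> X \<inter> T \<Longrightarrow> dist (act g y) (act g u) < \<epsilon>/2"
    using Eq_pointsE[OF y(1)] by metis
  have "T \<inter> orbit act x \<noteq> {}"
    using y(2) T open_Int_closure_eq_empty[of T "orbit act x"] by auto
  then obtain k where "act k x \<in> T"
    by (auto simp: orbit_def)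
  then have k: "act k x \<in> X \<inter> T"
    using G_systemD(2)[OF X x] by simp
  define W where "W = X \<inter> act k -` T"
  have "openin (top_of_set X) W"
    unfolding W_def using continuous_on_act[OF X] T(1)
    by (rule continuous_openin_preimage_gen)
  moreover have "x \<in> W"
    using x k by (simp add: W_def)
  moreover have "dist (act g x) (act g w) < \<epsilon>" if w: "w \<in> W" for w g
  proof -
    have split: "act g v = act (g - k) (act k v)" if "v \<in> X" for v
      using G_systemD(4)[OF X that, of "g - k" k] by simp
    have "dist (act g x) (act g w) = dist (act (g - k) (act k x)) (act (g - k) (act k w))"
      using split x w by (simp add: W_def)
    also have "\<dots> < \<epsilon>"
    proof (rule dist_triangle_half_r)
      show "dist (act (g - k) y) (act (g - k) (act k x)) < \<epsilon>/2"
        by (rule close[OF k])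
      show "dist (act (g - k) y) (act (g - k) (act k w)) < \<epsilon>/2"
        using w G_systemD(2)[OF X] by (intro close) (simp add: W_def)
    qed
    finally show ?thesis .
  qed
  ultimately show "\<exists>U. openin (top_of_set X) U \<and> x \<in> U \<and>
      (\<forall>u\<in>U. \<forall>g. dist (act g x) (act g u) < \<epsilon>)"
    by blast
qed

text \<open>The triangle inequality through a nearby point \<open>y\<close> of a minimal set: compactness turns an
  approximation of \<open>z\<close> by the orbit of \<open>x\<close> into a point \<open>y'\<close> of that minimal set whose orbit
  shadows the orbit of \<open>z\<close>, and by minimality the orbit of \<open>y'\<close> comes close to \<open>y\<close>.\<close>

lemma minimal_orbit_closure_of_Eq_point:
  assumes X: "G_system act X" and x: "x \<in> Eq_points act X"
    and lim: "x \<in> closure (\<Union>{Y. minimal_subset act X Y})"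
  shows "minimal_subset act X (closure (orbit act x))"
proof -
  have xX: "x \<in> X"
    using x by (simp add: Eq_points_def)
  have "x \<in> closure (orbit act z)" if z: "z \<in> closure (orbit act x)" for z
    unfolding closure_approachable
  proof (intro allI impI)
    fix e :: real
    assume "e > 0"
    \<comment> \<open>Three distances are to be controlled; the shadowing bound survives the passage to the
      limit only as a weak inequality, which the strict bounds on the other two make up for.\<close>
    define \<epsilon> where "\<epsilon> = e/3"
    have "\<epsilon> > 0"
      using \<open>e > 0\<close> by (simp add: \<epsilon>_def)
    obtain T where T: "open T" "x \<in> T"
        and close: "\<And>u g. u \<in> X \<inter> T \<Longrightarrow> dist (act g x) (act g u) < \<epsilon>"
      using Eq_pointsE[OF x \<open>\<epsilon> > 0\<close>] by metis
    have "T \<inter> \<Union>{Y. minimal_subset act X Y} \<noteq> {}"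
      using lim T open_Int_closure_eq_empty[of T "\<Union>{Y. minimal_subset act X Y}"] by auto
    then obtain Y y where Y: "minimal_subset act X Y" and y: "y \<in> Y" "y \<in> T"
      by blast
    have YX: "Y \<subseteq> X" and Yinv: "\<And>g v. v \<in> Y \<Longrightarrow> act g v \<in> Y"
      using Y by (auto simp: minimal_subset_def closed_invariant_def)
    have yT: "y \<in> X \<inter> T"
      using y YX by blast
    have "compact Y"
      using G_systemD(1)[OF G_system_closed_invariant[OF X]] Y
      by (auto simp: minimal_subset_def)
    obtain s where "\<And>n. s n \<in> orbit act x" and s: "s \<longlonglongrightarrow> z"
      using z unfolding closure_sequential by blast
    then obtain k where k: "\<And>n. s n = act (k n) x"
      unfolding orbit_def image_iff by metis
    have "\<forall>n. act (k n) y \<in> Y"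
      using Yinv y(1) by blast
    then obtain y' r where y': "y' \<in> Y" "strict_mono r"
        and lim': "((\<lambda>n. act (k n) y) \<circ> r) \<longlonglongrightarrow> y'"
      using \<open>compact Y\<close> unfolding compact_def by metis
    have zX: "z \<in> X"
      using z closed_invariant_orbit_closure[OF X xX] by (auto simp: closed_invariant_def)
    have shadow: "dist (act g z) (act g y') \<le> \<epsilon>" for g
    proof (rule tendsto_le[OF sequentially_bot tendsto_const tendsto_dist])
      show "(\<lambda>n. act g (act (k (r n)) x)) \<longlonglongrightarrow> act g z"
        using LIMSEQ_subseq_LIMSEQ[OF s y'(2)] k zX G_systemD(2)[OF X xX]
        by (intro continuous_on_tendsto_compose[OF continuous_on_act[OF X]]) (auto simp: o_def)
      show "(\<lambda>n. act g (act (k (r n)) y)) \<longlonglongrightarrow> act g y'"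
        using lim' y'(1) YX subsetD[OF YX Yinv[OF y(1)]]
        by (intro continuous_on_tendsto_compose[OF continuous_on_act[OF X]]) (auto simp: o_def)
      have "dist (act g (act (k (r n)) x)) (act g (act (k (r n)) y)) < \<epsilon>" for n
        using close[OF yT, of "g + k (r n)"] G_systemD(4)[OF X] xX y(1) YX by (metis subsetD)
      then show "\<forall>\<^sub>F n in sequentially.
          dist (act g (act (k (r n)) x)) (act g (act (k (r n)) y)) \<le> \<epsilon>"
        by (intro always_eventually allI less_imp_le)
    qed
    have "y \<in> closure (orbit act y')"
      using Y y(1) y'(1) by (auto simp: minimal_subset_def)
    then obtain g where g: "dist (act g y') y < \<epsilon>"
      using \<open>\<epsilon> > 0\<close> unfolding closure_approachable orbit_def by blast
    have "dist y x < \<epsilon>"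
      using close[OF yT, of 0] G_systemD(3)[OF X] xX y(1) YX by (metis dist_commute subsetD)
    then have "dist (act g z) x < e"
      using shadow[of g] g dist_triangle[of "act g z" x "act g y'"] dist_triangle[of "act g y'" x y]
      by (simp add: \<epsilon>_def)
    then show "\<exists>w\<in>orbit act z. dist w x < e"
      by (auto simp: orbit_def)
  qed
  moreover have "closed_invariant act X (closure (orbit act z))" if "z \<in> closure (orbit act x)" for z
    using that closed_invariant_orbit_closure[OF X] closed_invariant_orbit_closure[OF X xX]
    by (auto simp: closed_invariant_def)
  ultimately have "closure (orbit act x) \<subseteq> closure (orbit act z)" if "z \<in> closure (orbit act x)" for z
    using that orbit_closure_subset[OF X] by blast
  moreover have "closure (orbit act x) \<noteq> {}"
    using in_orbit_closure[OF X xX] by force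
  ultimately show ?thesis
    using closed_invariant_orbit_closure[OF X xX] by (simp add: minimal_subset_def)
qed

lemma equicontinuous_system_subset_Eq_points:
  assumes "Y \<subseteq> Eq_points act X"
  shows "equicontinuous_system act Y"
proof -
  have "y \<in> Eq_points act Y" if y: "y \<in> Y" for y
    unfolding Eq_points_def
  proof (intro CollectI conjI allI impI y)
    have yEq: "y \<in> Eq_points act X"
      using y assms by blast
    fix \<epsilon> :: real
    assume "\<epsilon> > 0"
    then obtain T where T: "open T" "y \<in> T"
        and close: "\<And>u g. u \<in> X \<inter> T \<Longrightarrow> dist (act g y) (act g u) < \<epsilon>"
      using Eq_pointsE[OF yEq] by metis
    moreover have "Y \<subseteq> X"
      using assms by (auto simp: Eq_points_def)
    ultimately show "\<exists>U. openin (top_of_set Y) U \<and> y \<in> U \<and>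
        (\<forall>u\<in>U. \<forall>g. dist (act g y) (act g u) < \<epsilon>)"
      using y by (intro exI[of _ "Y \<inter> T"]) (auto simp: openin_open_Int)
  qed
  then show ?thesis
    unfolding equicontinuous_system_def by (auto simp: Eq_points_def)
qed

section \<open>Equicontinuity points of the mincenter\<close>

theorem proposition12p2:
  fixes act :: "'g::topological_group_add \<Rightarrow> 'x::metric_space \<Rightarrow> 'x"
    and X M :: "'x set"
  assumes "G_system act X"
    and "RN_system TYPE('v::banach) act X"
    and "M = mincenter act X"
  shows "\<exists>F. disjoint F \<and> \<Union>F = Eq_points act M \<and>
           (\<forall>Y\<in>F. minimal_subset act X Y \<and> equicontinuous_system act Y \<and> capturing act X Y M)"
proof -
  note X = assms(1)
  have MX: "closed_invariant act X M"
    using closed_invariant_mincenter[OF X] assms(3) by simp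
  note M = G_system_closed_invariant[OF X MX]
  \<comment> \<open>The minimal subsets of \<open>X\<close> all lie in \<open>M\<close>, so \<open>M\<close> is its own mincenter.\<close>
  have "minimal_subset act M Y \<longleftrightarrow> minimal_subset act X Y" for Y
    using minimal_subset_subsystem[OF X MX] closure_subset[of "\<Union>{Y. minimal_subset act X Y}"]
    unfolding assms(3) mincenter_def by blast
  then have dense: "M = closure (\<Union>{Y. minimal_subset act M Y})"
    unfolding assms(3) mincenter_def by simp
  have EqM: "x \<in> M" if "x \<in> Eq_points act M" for x
    using that by (simp add: Eq_points_def)
  have min: "minimal_subset act M (closure (orbit act x))" if "x \<in> Eq_points act M" for x
    using minimal_orbit_closure_of_Eq_point[OF M that] dense EqM[OF that] by simp
  have sub: "closure (orbit act x) \<subseteq> Eq_points act M" if x: "x \<in> Eq_points act M" for x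
  proof
    fix y
    assume y: "y \<in> closure (orbit act x)"
    then have "closure (orbit act x) = closure (orbit act y)"
      by (rule minimal_subset_eq_orbit_closure[OF M min[OF x]])
    then have "x \<in> closure (orbit act y)"
      using in_orbit_closure[OF M EqM[OF x]] by simp
    moreover have "y \<in> M"
      using y min[OF x] by (auto simp: minimal_subset_def closed_invariant_def)
    ultimately show "y \<in> Eq_points act M"
      using Eq_points_pullback[OF M _ x] by blast
  qed
  define F where "F = (\<lambda>x. closure (orbit act x)) ` Eq_points act M"
  have F_min: "minimal_subset act M Y" and F_Eq: "Y \<subseteq> Eq_points act M" if "Y \<in> F" for Y
    using that min sub by (auto simp: F_def)
  have "Y = Z" if "Y \<in> F" "Z \<in> F" "y \<in> Y" "y \<in> Z" for Y Z y
    using that minimal_subset_eq_orbit_closure[OF M F_min] by metis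
  then have "disjoint F"
    unfolding disjoint_def by blast
  moreover have "\<Union>F = Eq_points act M"
    using sub in_orbit_closure[OF M EqM] unfolding F_def by blast
  moreover have "minimal_subset act X Y \<and> equicontinuous_system act Y \<and> capturing act X Y M"
    if Y: "Y \<in> F" for Y
  proof (intro conjI)
    show YX: "minimal_subset act X Y"
      using F_min[OF Y] minimal_subset_subsystem[OF X MX] by blast
    show "equicontinuous_system act Y"
      using F_Eq[OF Y] by (rule equicontinuous_system_subset_Eq_points)
    have "x \<in> Y" if x: "x \<in> M" and y: "y \<in> closure (orbit act x)" "y \<in> Y" for x y
    proof -
      have xEq: "x \<in> Eq_points act M"
        using Eq_points_pullback[OF M x _ y(1)] F_Eq[OF Y] y(2) by blast
      have "closure (orbit act x) = Y"
        using minimal_subset_eq_orbit_closure[OF M min[OF xEq] y(1)]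
          minimal_subset_eq_orbit_closure[OF M F_min[OF Y] y(2)] by simp
      then show ?thesis
        using in_orbit_closure[OF M x] by simp
    qed
    then show "capturing act X Y M"
      using YX MX F_Eq[OF Y] EqM unfolding capturing_def minimal_subset_def by blast
  qed
  ultimately show ?thesis
    by blast
qed

end
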